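(* Let $(X,f_{1,\infty})$ be a non-autonomous discrete system with $f_{1,\infty}$ feeble open and surjective and converging uniformly to a map $f$. If $\{f_n^{n+k}\}_{k\in\mathbb{N}}$ converges collectively to $\{f^k\}_{k\in\mathbb{N}}$, then $(X,f_{1,\infty})$ is weakly mixing if and only if $(X,f)$ is weakly mixing.
   Context: $\mathbb{N}=\{1,2,3,\dots\}$. A non-autonomous discrete system $(X,f_{1,\infty})$ consists of a compact metric space $(X,d)$ and a sequence $f_{1,\infty}=\{f_n\}_{n=1}^\infty$ of continuous maps $f_n:X\to X$. For $i,n\in\mathbb{N}$, $f_i^n:=f_{i+(n-1)}\circ\cdots\circ f_i$ (a composition of $n$ maps), and $f_i^0=id_X$. The autonomous system $(X,f)$ is the special case $f_n=f$ for all $n$. Uniform convergence of $f_{1,\infty}$ to $f:X\to X$ means $D(f_n,f)\to 0$, where $D(g,h)=\sup_{x\in X}d(g(x),h(x))$. "$\{f_n^{n+k}\}_{k\in\mathbb{N}}$ converges collectively to $\{f^k\}_{k\in\mathbb{N}}$" means: for every $\varepsilon>0$ there exists $r_0\in\mathbb{N}$ such that $D(f_r^k,f^k)<\varepsilon$ for all $r\ge r_0$ and all $k\in\mathbb{N}$, where $f_r^k=f_{r+k-1}\circ\cdots\circ f_r$ and $f^k$ is the $k$-fold composition of $f$. $f_{1,\infty}$ is surjective if every $f_i$ is surjective. It is feeble open if $\mathrm{int}(f_i(U))\neq\emptyset$ for every nonempty open $U\subseteq X$ and every $i\in\mathbb{N}$. The system $(X,f_{1,\infty})$ is weakly mixing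 if for any four nonempty open subsets $U_1,U_2,V_1,V_2\subseteq X$ there exists $n\in\mathbb{N}$ such that $f_1^n(U_1)\cap V_1\neq\emptyset$ and $f_1^n(U_2)\cap V_2\neq\emptyset$. *)

theory Defs
  imports "HOL-Analysis.Analysis"
begin

text \<open>
  The space is a compact subset \<open>X\<close> of a metric space type, and open sets, interiors and
  continuity are all taken relative to \<open>X\<close>. Sequences of maps are indexed from 1:
  the value of \<open>F\<close> at index 0 is irrelevant.
\<close>

definition nonautonomous_system :: "'a::metric_space set \<Rightarrow> (nat \<Rightarrow> 'a \<Rightarrow> 'a) \<Rightarrow> bool" where
  "nonautonomous_system X F \<longleftrightarrow>
     compact X \<and> (\<forall>n\<ge>1. continuous_on X (F n) \<and> F n \<in> X \<rightarrow> X)"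

text \<open>\<open>iter_comp F i n\<close> is $f_i^n = f_{i+(n-1)} \circ \cdots \circ f_i$, a composition of \<open>n\<close> maps.\<close>

fun iter_comp :: "(nat \<Rightarrow> 'a \<Rightarrow> 'a) \<Rightarrow> nat \<Rightarrow> nat \<Rightarrow> 'a \<Rightarrow> 'a" where
  "iter_comp F i 0 = id"
| "iter_comp F i (Suc n) = F (i + n) \<circ> iter_comp F i n"

text \<open>
  For self-maps of a nonempty compact \<open>X\<close> the supremum is over a nonempty bounded set of reals,
  so it is the true supremum.
\<close>

definition sup_dist :: "'a::metric_space set \<Rightarrow> ('a \<Rightarrow> 'a) \<Rightarrow> ('a \<Rightarrow> 'a) \<Rightarrow> real" where
  "sup_dist X g h = (SUP x\<in>X. dist (g x) (h x))"

definition converges_uniformly ::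
    "'a::metric_space set \<Rightarrow> (nat \<Rightarrow> 'a \<Rightarrow> 'a) \<Rightarrow> ('a \<Rightarrow> 'a) \<Rightarrow> bool" where
  "converges_uniformly X F f \<longleftrightarrow> (\<lambda>n. sup_dist X (F n) f) \<longlonglongrightarrow> 0"

definition converges_collectively ::
    "'a::metric_space set \<Rightarrow> (nat \<Rightarrow> 'a \<Rightarrow> 'a) \<Rightarrow> ('a \<Rightarrow> 'a) \<Rightarrow> bool" where
  "converges_collectively X F f \<longleftrightarrow>
     (\<forall>\<epsilon>>0. \<exists>r0\<ge>1. \<forall>r\<ge>r0. \<forall>k\<ge>1. sup_dist X (iter_comp F r k) (f ^^ k) < \<epsilon>)"

definition surjective_system :: "'a set \<Rightarrow> (nat \<Rightarrow> 'a \<Rightarrow> 'a) \<Rightarrow> bool" where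
  "surjective_system X F \<longleftrightarrow> (\<forall>i\<ge>1. F i ` X = X)"

definition feeble_open :: "'a::metric_space set \<Rightarrow> (nat \<Rightarrow> 'a \<Rightarrow> 'a) \<Rightarrow> bool" where
  "feeble_open X F \<longleftrightarrow>
     (\<forall>i\<ge>1. \<forall>U. openin (top_of_set X) U \<and> U \<noteq> {} \<longrightarrow>
        top_of_set X interior_of (F i ` U) \<noteq> {})"

definition weakly_mixing :: "'a::metric_space set \<Rightarrow> (nat \<Rightarrow> 'a \<Rightarrow> 'a) \<Rightarrow> bool" where
  "weakly_mixing X F \<longleftrightarrow>
     (\<forall>U1 U2 V1 V2.
        openin (top_of_set X) U1 \<and> U1 \<noteq> {} \<and> openin (top_of_set X) U2 \<and> U2 \<noteq> {} \<and>
        openin (top_of_set X) V1 \<and> V1 \<noteq> {} \<and> openin (top_of_set X) V2 \<and> V2 \<noteq> {} \<longrightarrow>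
        (\<exists>n\<ge>1. iter_comp F 1 n ` U1 \<inter> V1 \<noteq> {} \<and> iter_comp F 1 n ` U2 \<inter> V2 \<noteq> {}))"

end

theory Submission
  imports Defs
begin

text \<open>
  Split \<open>f\<^sub>1\<^sup>n\<close> as \<open>f\<^sub>r\<^sup>k \<circ> f\<^sub>1\<^sup>r\<^sup>-\<^sup>1\<close> with \<open>n = r - 1 + k\<close> and \<open>r\<close> so large that \<open>f\<^sub>r\<^sup>k\<close> is
  uniformly close to \<open>f\<^sup>k\<close> for every \<open>k\<close>. The initial block \<open>f\<^sub>1\<^sup>r\<^sup>-\<^sup>1\<close> is continuous,
  surjective and feeble open, so the open sets \<open>U\<^sub>i\<close> can be pushed forward through it (from
  \<open>f\<close> to the system) or pulled back (from the system to \<open>f\<close>). The second direction needs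
  mixing times \<open>n \<ge> r\<close>; these exist because a weakly mixing system with more than one point
  has no isolated points, so that hits at finitely many times can be avoided by shrinking
  the open sets.
\<close>

section \<open>Compositions of the maps and the uniform distance\<close>

lemma iter_comp_add:
  "iter_comp F i (m + n) = iter_comp F (i + m) n \<circ> iter_comp F i m"
  by (induction n) (auto simp: add.assoc)

lemma iter_comp_const: "iter_comp (\<lambda>_. f) i n = f ^^ n"
  by (induction n) auto

lemma funpow_funcset: "f \<in> X \<rightarrow> X \<Longrightarrow> f ^^ k \<in> X \<rightarrow> X"
  by (induction k) auto

lemma iter_comp_funcset:
  assumes "nonautonomous_system X F" "i \<ge> 1"
  shows "iter_comp F i n \<in> X \<rightarrow> X"
proof (induction n)
  case (Suc n)
  have "F (i + n) \<in> X \<rightarrow> X"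
    using assms by (simp add: nonautonomous_system_def)
  with Suc show ?case by auto
qed auto

lemma continuous_on_iter_comp:
  assumes "nonautonomous_system X F" "i \<ge> 1"
  shows "continuous_on X (iter_comp F i n)"
proof (induction n)
  case (Suc n)
  have "continuous_on X (F (i + n))"
    using assms by (simp add: nonautonomous_system_def)
  moreover have "iter_comp F i n ` X \<subseteq> X"
    using iter_comp_funcset[OF assms] by blast
  ultimately show ?case
    unfolding iter_comp.simps by (metis Suc continuous_on_compose continuous_on_subset)
qed (simp add: id_def)

lemma iter_comp_image:
  assumes "surjective_system X F" "i \<ge> 1"
  shows "iter_comp F i n ` X = X"
proof (induction n)
  case (Suc n)
  have "F (i + n) ` X = X"
    using assms by (simp add: surjective_system_def)
  with Suc show ?case by (metis image_comp iter_comp.simps(2))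
qed auto

lemma openin_iter_comp_vimage:
  assumes "nonautonomous_system X F" "i \<ge> 1" "openin (top_of_set X) V"
  shows "openin (top_of_set X) (X \<inter> iter_comp F i n -` V)"
  using continuous_openin_preimage[OF continuous_on_iter_comp iter_comp_funcset] assms by blast

text \<open>The image of an open set need not be open, so the induction carries a nonempty open
  subset \<open>W\<close> of the image. The interior of the image of \<open>W\<close> under the next
  map is the new subset.\<close>

lemma feeble_open_iter_comp:
  assumes "feeble_open X F" "i \<ge> 1" "openin (top_of_set X) U" "U \<noteq> {}"
  obtains W where "openin (top_of_set X) W" "W \<noteq> {}" "W \<subseteq> iter_comp F i n ` U"
proof (induction n arbitrary: thesis)
  case 0
  show ?case by (rule 0[of U]) (use assms in auto)
next
  case (Suc n)
  obtain W where W: "openin (top_of_set X) W" "W \<noteq> {}" "W \<subseteq> iter_comp F i n ` U"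
    using Suc.IH by blast
  show ?case
  proof (rule Suc.prems)
    show "top_of_set X interior_of (F (i + n) ` W) \<noteq> {}"
      using assms W by (simp add: feeble_open_def)
    show "top_of_set X interior_of (F (i + n) ` W) \<subseteq> iter_comp F i (Suc n) ` U"
      using W(3) interior_of_subset[of "top_of_set X" "F (i + n) ` W"] by fastforce
  qed simp
qed

text \<open>Compactness bounds all the distances by the diameter of \<open>X\<close>. The supremum
  is therefore a genuine upper bound, and estimates on \<open>sup_dist\<close> become pointwise
  ones.\<close>

lemma dist_le_sup_dist:
  assumes "compact X" "g \<in> X \<rightarrow> X" "h \<in> X \<rightarrow> X" "x \<in> X"
  shows "dist (g x) (h x) \<le> sup_dist X g h"
  unfolding sup_dist_def
proof (rule cSUP_upper[OF assms(4)])
  have "dist (g y) (h y) \<le> diameter X" if "y \<in> X" for y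
    using assms that by (intro diameter_bounded_bound compact_imp_bounded) auto
  then show "bdd_above ((\<lambda>x. dist (g x) (h x)) ` X)"
    by (intro bdd_aboveI2)
qed

section \<open>Hitting times and targets in weakly mixing systems\<close>

lemma weakly_mixingD:
  assumes "weakly_mixing X F"
    and "openin (top_of_set X) U1" "U1 \<noteq> {}" "openin (top_of_set X) U2" "U2 \<noteq> {}"
    and "openin (top_of_set X) V1" "V1 \<noteq> {}" "openin (top_of_set X) V2" "V2 \<noteq> {}"
  obtains n where "n \<ge> 1" "iter_comp F 1 n ` U1 \<inter> V1 \<noteq> {}" "iter_comp F 1 n ` U2 \<inter> V2 \<noteq> {}"
  using assms(1)[unfolded weakly_mixing_def, rule_format, of U1 U2 V1 V2] assms(2-) by blast

text \<open>If \<open>{x}\<close> were open and \<open>X\<close> had another point,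
  \<open>{x}\<close> could serve as both source sets, with disjoint neighbourhoods as targets. The
  single image point at the common time would then lie in both.\<close>

lemma weakly_mixing_not_isolated:
  assumes "weakly_mixing X F" "openin (top_of_set X) {x}"
  shows "X = {x}"
proof (rule ccontr)
  have "x \<in> X" using assms(2) openin_imp_subset by blast
  moreover assume "X \<noteq> {x}"
  ultimately obtain y where y: "y \<in> X" "y \<noteq> x" by blast
  obtain A B where AB: "open A" "open B" "x \<in> A" "y \<in> B" "A \<inter> B = {}"
    using hausdorff y(2) by metis
  obtain n where "iter_comp F 1 n ` {x} \<inter> (X \<inter> A) \<noteq> {}" "iter_comp F 1 n ` {x} \<inter> (X \<inter> B) \<noteq> {}"
    by (rule weakly_mixingD[OF assms(1,2) _ assms(2), of "X \<inter> A" "X \<inter> B"])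
      (use AB y \<open>x \<in> X\<close> in auto)
  then show False using AB(5) by auto
qed

text \<open>The times are excluded one by one. At time \<open>N\<close>, a point of the target other
  than the image of some \<open>u\<close> in the source is separated from that image by disjoint
  open sets, and continuity pulls the separation back to a neighbourhood of \<open>u\<close>.
  Shrinking further keeps the times already excluded.\<close>

lemma shrink_to_avoid:
  assumes sys: "nonautonomous_system X F"
    and no_isolated: "\<And>x. \<not> openin (top_of_set X) {x}"
    and "openin (top_of_set X) U" "U \<noteq> {}" "openin (top_of_set X) V" "V \<noteq> {}"
  obtains U' V' where "openin (top_of_set X) U'" "U' \<noteq> {}" "U' \<subseteq> U"
    "openin (top_of_set X) V'" "V' \<noteq> {}" "V' \<subseteq> V"
    "\<And>n. n < N \<Longrightarrow> iter_comp F 1 n ` U' \<inter> V' = {}"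
proof (induction N arbitrary: thesis)
  case 0
  show ?case by (rule 0[of U V]) (use assms in auto)
next
  case (Suc N)
  obtain U' V' where
    U': "openin (top_of_set X) U'" "U' \<noteq> {}" "U' \<subseteq> U" and
    V': "openin (top_of_set X) V'" "V' \<noteq> {}" "V' \<subseteq> V" and
    avoid: "\<And>n. n < N \<Longrightarrow> iter_comp F 1 n ` U' \<inter> V' = {}"
    using Suc.IH by blast
  let ?g = "iter_comp F 1 N"
  obtain u where u: "u \<in> U'" using U'(2) by blast
  have uX: "u \<in> X" using u U'(1) openin_imp_subset by blast
  \<comment> \<open>The absence of isolated points enters here: the open target cannot consist of
    the image of \<open>u\<close> alone.\<close>
  have "V' \<noteq> {?g u}" using no_isolated V'(1) by metis
  then obtain v where v: "v \<in> V'" "v \<noteq> ?g u" using V'(2) by blast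
  obtain A B where AB: "open A" "open B" "?g u \<in> A" "v \<in> B" "A \<inter> B = {}"
    using hausdorff v(2) by metis
  have guX: "?g u \<in> X" using iter_comp_funcset[OF sys, of 1 N] uX by auto
  show ?case
  proof (rule Suc.prems)
    show "openin (top_of_set X) (U' \<inter> (X \<inter> ?g -` (X \<inter> A)))"
      by (intro openin_Int U' openin_iter_comp_vimage sys openin_open_Int AB) simp
    show "U' \<inter> (X \<inter> ?g -` (X \<inter> A)) \<noteq> {}" using u uX guX AB by blast
    show "openin (top_of_set X) (V' \<inter> B)"
      using V'(1) AB(2) openin_Int_open by blast
    show "V' \<inter> B \<noteq> {}" using v AB by blast
    show "iter_comp F 1 n ` (U' \<inter> (X \<inter> ?g -` (X \<inter> A))) \<inter> (V' \<inter> B) = {}" if "n < Suc N" for n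
    proof (cases "n = N")
      case True
      then show ?thesis using AB(5) by blast
    next
      case False
      with that have "n < N" by simp
      then show ?thesis using avoid[of n] by blast
    qed
  qed (use U'(3) V'(3) in auto)
qed

text \<open>Both hits happen at the same time, so making the first pair of sets avoid all times
  below \<open>N\<close> forces the common time to be late. The second pair stays as it is.\<close>

lemma weakly_mixing_late:
  assumes sys: "nonautonomous_system X F" and wm: "weakly_mixing X F"
    and U1: "openin (top_of_set X) U1" "U1 \<noteq> {}" and U2: "openin (top_of_set X) U2" "U2 \<noteq> {}"
    and V1: "openin (top_of_set X) V1" "V1 \<noteq> {}" and V2: "openin (top_of_set X) V2" "V2 \<noteq> {}"
  obtains n where "n \<ge> N" "iter_comp F 1 n ` U1 \<inter> V1 \<noteq> {}" "iter_comp F 1 n ` U2 \<inter> V2 \<noteq> {}"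
proof (cases "\<exists>x. openin (top_of_set X) {x}")
  case True
  then obtain x where X: "X = {x}" using weakly_mixing_not_isolated[OF wm] by blast
  \<comment> \<open>In a one-point space every nonempty open set is the whole space, so time
    \<open>N\<close> itself serves.\<close>
  have eq: "W = {x}" if "openin (top_of_set X) W" "W \<noteq> {}" for W
    using openin_imp_subset[OF that(1)] that(2) X by blast
  have "iter_comp F 1 N x = x" using iter_comp_funcset[OF sys, of 1 N] X by auto
  then show ?thesis using that[of N] by (simp add: eq[OF U1] eq[OF U2] eq[OF V1] eq[OF V2])
next
  case False
  then have no_isolated: "\<And>x. \<not> openin (top_of_set X) {x}" by blast
  obtain U' V' where
    U': "openin (top_of_set X) U'" "U' \<noteq> {}" "U' \<subseteq> U1" and
    V': "openin (top_of_set X) V'" "V' \<noteq> {}" "V' \<subseteq> V1" and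
    avoid: "\<And>n. n < N \<Longrightarrow> iter_comp F 1 n ` U' \<inter> V' = {}"
    using shrink_to_avoid[OF sys no_isolated U1 V1] by metis
  obtain n where n: "iter_comp F 1 n ` U' \<inter> V' \<noteq> {}" "iter_comp F 1 n ` U2 \<inter> V2 \<noteq> {}"
    using weakly_mixingD[OF wm U'(1,2) U2 V'(1,2) V2] by metis
  show ?thesis
  proof (rule that)
    show "n \<ge> N" using avoid n(1) not_le by blast
    show "iter_comp F 1 n ` U1 \<inter> V1 \<noteq> {}" using n(1) U'(3) V'(3) by blast
  qed (rule n(2))
qed

text \<open>Hits on \<open>W\<close> survive an error below the margin and become hits on
  \<open>V\<close>, which allows one composition to be exchanged for a nearby one. Half the radius
  of a ball goes to \<open>W\<close>, the other half to the error.\<close>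

lemma open_target_margin:
  assumes "openin (top_of_set X) V" "V \<noteq> {}"
  obtains \<epsilon> W where "\<epsilon> > 0" "openin (top_of_set X) W" "W \<noteq> {}"
    "\<And>y z. y \<in> W \<Longrightarrow> z \<in> X \<Longrightarrow> dist y z < \<epsilon> \<Longrightarrow> z \<in> V"
proof -
  obtain v where v: "v \<in> V" using assms(2) by blast
  then obtain e where e: "e > 0" "ball v e \<inter> X \<subseteq> V"
    using assms(1) by (auto simp: openin_contains_ball)
  have vX: "v \<in> X" using v assms(1) openin_imp_subset by blast
  show ?thesis
  proof (rule that[of "e/2" "X \<inter> ball v (e/2)"])
    show "X \<inter> ball v (e/2) \<noteq> {}" using vX e by auto
    show "openin (top_of_set X) (X \<inter> ball v (e/2))" by auto
    fix y z assume y: "y \<in> X \<inter> ball v (e/2)" and z: "z \<in> X" and "dist y z < e/2"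
    then have "z \<in> ball v e" using dist_triangle[of v z y] by auto
    then show "z \<in> V" using e z by blast
  qed (use e in auto)
qed

theorem theorem10:
  fixes X :: "'a::metric_space set" and F :: "nat \<Rightarrow> 'a \<Rightarrow> 'a" and f :: "'a \<Rightarrow> 'a"
  assumes "nonautonomous_system X F"
    and "feeble_open X F"
    and "surjective_system X F"
    and "f \<in> X \<rightarrow> X"
    and "converges_uniformly X F f"
    and "converges_collectively X F f"
  shows "weakly_mixing X F \<longleftrightarrow> weakly_mixing X (\<lambda>_. f)"
proof -
  note sys = assms(1)
  have cpt: "compact X" using sys by (simp add: nonautonomous_system_def)
  \<comment> \<open>With \<open>r = 1 + m\<close>, the composition
    \<open>iter_comp F (1 + m) k\<close> is exactly what follows the initial block
    \<open>iter_comp F 1 m\<close>.\<close>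
  have close: "\<exists>m. \<forall>k\<ge>1. \<forall>x\<in>X. dist (iter_comp F (1 + m) k x) ((f ^^ k) x) < \<epsilon>"
    if "\<epsilon> > 0" for \<epsilon>
  proof -
    obtain r where r: "r \<ge> 1" "\<forall>k\<ge>1. sup_dist X (iter_comp F r k) (f ^^ k) < \<epsilon>"
      using assms(6) \<open>\<epsilon> > 0\<close> unfolding converges_collectively_def by (meson order_refl)
    have "dist (iter_comp F r k x) ((f ^^ k) x) < \<epsilon>" if "k \<ge> 1" "x \<in> X" for k x
      using r(2) that
      by (meson dist_le_sup_dist[OF cpt iter_comp_funcset[OF sys r(1)] funpow_funcset[OF assms(4)]]
          le_less_trans)
    then show ?thesis using r(1) by (intro exI[of _ "r - 1"]) simp
  qed
  show ?thesis
  proof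
    assume wm: "weakly_mixing X F"
    show "weakly_mixing X (\<lambda>_. f)"
      unfolding weakly_mixing_def iter_comp_const
    proof (intro allI impI, elim conjE)
      fix U1 U2 V1 V2
      assume U1: "openin (top_of_set X) U1" "U1 \<noteq> {}" and U2: "openin (top_of_set X) U2" "U2 \<noteq> {}"
        and V1: "openin (top_of_set X) V1" "V1 \<noteq> {}" and V2: "openin (top_of_set X) V2" "V2 \<noteq> {}"
      obtain e1 W1 where W1: "e1 > 0" "openin (top_of_set X) W1" "W1 \<noteq> {}"
        "\<And>y z. y \<in> W1 \<Longrightarrow> z \<in> X \<Longrightarrow> dist y z < e1 \<Longrightarrow> z \<in> V1"
        using open_target_margin[OF V1] by metis
      obtain e2 W2 where W2: "e2 > 0" "openin (top_of_set X) W2" "W2 \<noteq> {}"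
        "\<And>y z. y \<in> W2 \<Longrightarrow> z \<in> X \<Longrightarrow> dist y z < e2 \<Longrightarrow> z \<in> V2"
        using open_target_margin[OF V2] by metis
      obtain m where m: "\<And>k x. k \<ge> 1 \<Longrightarrow> x \<in> X \<Longrightarrow>
          dist (iter_comp F (1 + m) k x) ((f ^^ k) x) < min e1 e2"
        using close[of "min e1 e2"] W1(1) W2(1) by auto
      let ?g = "iter_comp F 1 m"
      have pull: "openin (top_of_set X) (X \<inter> ?g -` U)" "X \<inter> ?g -` U \<noteq> {}"
        if "openin (top_of_set X) U" "U \<noteq> {}" for U
      proof -
        show "openin (top_of_set X) (X \<inter> ?g -` U)"
          using openin_iter_comp_vimage[OF sys _ that(1)] by simp
        \<comment> \<open>Surjectivity of the initial block keeps the pulled-back sets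
          nonempty.\<close>
        have "U \<subseteq> ?g ` X"
          using openin_imp_subset[OF that(1)] iter_comp_image[OF assms(3), of 1 m] by simp
        then show "X \<inter> ?g -` U \<noteq> {}" using that(2) by blast
      qed
      \<comment> \<open>The bound is \<open>Suc m\<close> rather than \<open>m\<close> because the
        closeness estimate covers only \<open>k\<close> at least 1.\<close>
      obtain n where n: "n \<ge> Suc m" "iter_comp F 1 n ` (X \<inter> ?g -` U1) \<inter> W1 \<noteq> {}"
        "iter_comp F 1 n ` (X \<inter> ?g -` U2) \<inter> W2 \<noteq> {}"
        by (rule weakly_mixing_late[OF sys wm pull[OF U1] pull[OF U2] W1(2,3) W2(2,3)])
      define k where "k = n - m"
      have k: "k \<ge> 1" "n = m + k" using n(1) by (auto simp: k_def)
      \<comment> \<open>Stated for a generic pair, so that both hits at time \<open>n\<close> are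
        converted with the same \<open>k\<close>. The point of \<open>U\<close> that
        \<open>f ^^ k\<close> sends into \<open>V\<close> is \<open>?g x\<close>, not
        \<open>x\<close>.\<close>
      have transfer: "(f ^^ k) ` U \<inter> V \<noteq> {}"
        if hit: "iter_comp F 1 n ` (X \<inter> ?g -` U) \<inter> W \<noteq> {}" and "min e1 e2 \<le> e"
          and near: "\<And>y z. y \<in> W \<Longrightarrow> z \<in> X \<Longrightarrow> dist y z < e \<Longrightarrow> z \<in> V" for U V W e
      proof -
        obtain x where x: "x \<in> X" "?g x \<in> U" "iter_comp F (1 + m) k (?g x) \<in> W"
          using hit unfolding k(2) iter_comp_add o_def by blast
        have gx: "?g x \<in> X" using iter_comp_funcset[OF sys, of 1 m] x(1) by auto
        have "(f ^^ k) (?g x) \<in> V"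
        proof (rule near[OF x(3)])
          show "(f ^^ k) (?g x) \<in> X" using funpow_funcset[OF assms(4)] gx by blast
          show "dist (iter_comp F (1 + m) k (?g x)) ((f ^^ k) (?g x)) < e"
            using m[OF k(1) gx] \<open>min e1 e2 \<le> e\<close> by linarith
        qed
        with x(2) show ?thesis by blast
      qed
      show "\<exists>n\<ge>1. (f ^^ n) ` U1 \<inter> V1 \<noteq> {} \<and> (f ^^ n) ` U2 \<inter> V2 \<noteq> {}"
      proof (intro exI[of _ k] conjI)
        show "(f ^^ k) ` U1 \<inter> V1 \<noteq> {}" by (rule transfer[OF n(2) _ W1(4)]) auto
        show "(f ^^ k) ` U2 \<inter> V2 \<noteq> {}" by (rule transfer[OF n(3) _ W2(4)]) auto
      qed (rule k(1))
    qed
  next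
    assume wm: "weakly_mixing X (\<lambda>_. f)"
    show "weakly_mixing X F"
      unfolding weakly_mixing_def
    proof (intro allI impI, elim conjE)
      fix U1 U2 V1 V2
      assume U1: "openin (top_of_set X) U1" "U1 \<noteq> {}" and U2: "openin (top_of_set X) U2" "U2 \<noteq> {}"
        and V1: "openin (top_of_set X) V1" "V1 \<noteq> {}" and V2: "openin (top_of_set X) V2" "V2 \<noteq> {}"
      obtain e1 W1 where W1: "e1 > 0" "openin (top_of_set X) W1" "W1 \<noteq> {}"
        "\<And>y z. y \<in> W1 \<Longrightarrow> z \<in> X \<Longrightarrow> dist y z < e1 \<Longrightarrow> z \<in> V1"
        using open_target_margin[OF V1] by metis
      obtain e2 W2 where W2: "e2 > 0" "openin (top_of_set X) W2" "W2 \<noteq> {}"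
        "\<And>y z. y \<in> W2 \<Longrightarrow> z \<in> X \<Longrightarrow> dist y z < e2 \<Longrightarrow> z \<in> V2"
        using open_target_margin[OF V2] by metis
      obtain m where m: "\<And>k x. k \<ge> 1 \<Longrightarrow> x \<in> X \<Longrightarrow>
          dist (iter_comp F (1 + m) k x) ((f ^^ k) x) < min e1 e2"
        using close[of "min e1 e2"] W1(1) W2(1) by auto
      let ?g = "iter_comp F 1 m"
      \<comment> \<open>Feeble openness supplies open sources for \<open>f\<close> whose points all
        have preimages in the original sources under the initial block.\<close>
      obtain P1 where P1: "openin (top_of_set X) P1" "P1 \<noteq> {}" "P1 \<subseteq> ?g ` U1"
        by (rule feeble_open_iter_comp[OF assms(2) order_refl U1])
      obtain P2 where P2: "openin (top_of_set X) P2" "P2 \<noteq> {}" "P2 \<subseteq> ?g ` U2"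
        by (rule feeble_open_iter_comp[OF assms(2) order_refl U2])
      obtain k where k: "k \<ge> 1" "(f ^^ k) ` P1 \<inter> W1 \<noteq> {}" "(f ^^ k) ` P2 \<inter> W2 \<noteq> {}"
        by (rule weakly_mixingD[OF wm P1(1,2) P2(1,2) W1(2,3) W2(2,3), unfolded iter_comp_const])
      \<comment> \<open>Here \<open>f ^^ k\<close> hits the shrunken target and the system is the
        perturbation. A preimage \<open>u\<close> of the hitting point \<open>p\<close> under the
        initial block turns \<open>k\<close> steps from \<open>p\<close> into \<open>m + k\<close>
        steps from \<open>u\<close>.\<close>
      have transfer: "iter_comp F 1 (m + k) ` U \<inter> V \<noteq> {}"
        if hit: "(f ^^ k) ` P \<inter> W \<noteq> {}" and "min e1 e2 \<le> e"
          and near: "\<And>y z. y \<in> W \<Longrightarrow> z \<in> X \<Longrightarrow> dist y z < e \<Longrightarrow> z \<in> V"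
          and P: "openin (top_of_set X) P" "P \<subseteq> ?g ` U" for U V W P e
      proof -
        obtain p where p: "p \<in> P" "(f ^^ k) p \<in> W" using hit by blast
        then obtain u where u: "u \<in> U" "p = ?g u" using P(2) by blast
        have pX: "p \<in> X" using p(1) openin_imp_subset[OF P(1)] by blast
        have "iter_comp F (1 + m) k p \<in> V"
        proof (rule near[OF p(2)])
          show "iter_comp F (1 + m) k p \<in> X"
            using iter_comp_funcset[OF sys, of "1 + m" k] pX by auto
          show "dist ((f ^^ k) p) (iter_comp F (1 + m) k p) < e"
            using m[OF k(1) pX] \<open>min e1 e2 \<le> e\<close>
            by (metis dist_commute order_less_le_trans)
        qed
        then have "iter_comp F 1 (m + k) u \<in> V"
          by (simp add: iter_comp_add u(2))
        with u(1) show ?thesis by blast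
      qed
      show "\<exists>n\<ge>1. iter_comp F 1 n ` U1 \<inter> V1 \<noteq> {} \<and> iter_comp F 1 n ` U2 \<inter> V2 \<noteq> {}"
      proof (intro exI[of _ "m + k"] conjI)
        show "1 \<le> m + k" using k(1) by simp
        show "iter_comp F 1 (m + k) ` U1 \<inter> V1 \<noteq> {}"
          by (rule transfer[OF k(2) _ W1(4) P1(1,3)]) auto
        show "iter_comp F 1 (m + k) ` U2 \<inter> V2 \<noteq> {}"
          by (rule transfer[OF k(3) _ W2(4) P2(1,3)]) auto
      qed
    qed
  qed
qed

end
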